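(* Let $\xi(t)$, $t\in\mathbb{R}$, be a stationary continuous time process with finite second moment and correlation function $b(t)$, and for $0<T<\infty$ let $B_T$ be the integral operator in $L_2(0,T)$ given by $$(B_Tf)(t)=\int_0^T b(t-s)f(s)\,ds.$$ Then $\xi(t)$ is stable if and only if the Hilbert (operator) norms $\|B_T\|$ satisfy $$\lim_{T\to\infty}\frac{1}{T}\|B_T\|=0.$$ Otherwise, $$\lim_{T\to\infty}\frac{1}{T}\|B_T\|=\max_\alpha m_\alpha,$$ where $\{m_\alpha\}$ is the set of jumps of the spectral distribution function $\vartheta$ of the process.
   Context: The correlation function $b$ of the process is a continuous Hermitian positive (i.e. positive definite) function on $\mathbb{R}$ and admits the representation $$b(t)=\int_{-\infty}^{\infty}e^{i\lambda t}\,d\vartheta(\lambda),$$ where the spectral distribution function $\vartheta$ is a bounded non-decreasing function on the real axis. The process is called stable if $\vartheta$ is continuous, and unstable otherwise. The $m_\alpha=\vartheta(\lambda_\alpha+0)-\vartheta(\lambda_\alpha-0)$ are the jumps of $\vartheta$ at its (at most countably many) discontinuity points $\lambda_\alpha$. *)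

theory Defs
  imports "HOL-Probability.Probability"
begin

text \<open>Stationarity is meant in the wide sense; a strictly stationary process with finite second
  moments is a special case. The mean is not subtracted in the correlation function, so the centred
  convention is the special case of a process with mean zero.\<close>

definition stationary_process :: "'a measure \<Rightarrow> (real \<Rightarrow> 'a \<Rightarrow> complex) \<Rightarrow> bool" where
  "stationary_process M \<xi> \<longleftrightarrow>
     prob_space M \<and>
     (\<forall>t. \<xi> t \<in> borel_measurable M \<and> integrable M (\<lambda>\<omega>. (cmod (\<xi> t \<omega>))\<^sup>2)) \<and>
     (\<forall>t h. (CLINT \<omega>|M. \<xi> (t + h) \<omega>) = (CLINT \<omega>|M. \<xi> t \<omega>)) \<and>
     (\<forall>t s h. (CLINT \<omega>|M. \<xi> (t + h) \<omega> * cnj (\<xi> (s + h) \<omega>))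
            = (CLINT \<omega>|M. \<xi> t \<omega> * cnj (\<xi> s \<omega>)))"

definition correlation_function ::
    "'a measure \<Rightarrow> (real \<Rightarrow> 'a \<Rightarrow> complex) \<Rightarrow> real \<Rightarrow> complex" where
  "correlation_function M \<xi> t = (CLINT \<omega>|M. \<xi> t \<omega> * cnj (\<xi> 0 \<omega>))"

text \<open>No one-sided continuity of \<open>\<theta>\<close> is assumed, whereas \<^const>\<open>interval_measure\<close> is meaningful only
  for right-continuous functions; hence the passage to the right limits, which gives
  \<open>{a<..b}\<close> the mass \<open>\<theta>(b+0) - \<theta>(a+0)\<close>.\<close>

definition stieltjes_measure :: "(real \<Rightarrow> real) \<Rightarrow> real measure" where
  "stieltjes_measure \<theta> = interval_measure (\<lambda>x. Lim (at_right x) \<theta>)"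

definition spectral_distribution :: "(real \<Rightarrow> complex) \<Rightarrow> (real \<Rightarrow> real) \<Rightarrow> bool" where
  "spectral_distribution b \<theta> \<longleftrightarrow>
     mono \<theta> \<and> bounded (range \<theta>) \<and>
     (\<forall>t. b t = (CLINT l|stieltjes_measure \<theta>. iexp (l * t)))"

text \<open>The function \<open>\<theta>\<close> is determined by \<open>b\<close> only up to an additive constant and its values at the
  discontinuity points; neither affects its continuity.\<close>

definition stable_process :: "'a measure \<Rightarrow> (real \<Rightarrow> 'a \<Rightarrow> complex) \<Rightarrow> bool" where
  "stable_process M \<xi> \<longleftrightarrow>
     (\<exists>\<theta>. spectral_distribution (correlation_function M \<xi>) \<theta> \<and> continuous_on UNIV \<theta>)"

definition jumps :: "(real \<Rightarrow> real) \<Rightarrow> real set" where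
  "jumps \<theta> = {Lim (at_right l) \<theta> - Lim (at_left l) \<theta> | l. \<not> isCont \<theta> l}"

text \<open>Elements of \<open>L\<^sub>2(0,T)\<close> are represented by Borel functions, without passing to classes
  modulo null sets.\<close>

definition L2_space :: "real \<Rightarrow> (real \<Rightarrow> complex) set" where
  "L2_space T = {f \<in> borel_measurable (restrict_space lborel {0<..<T}).
     integrable (restrict_space lborel {0<..<T}) (\<lambda>t. (cmod (f t))\<^sup>2)}"

definition L2_norm :: "real \<Rightarrow> (real \<Rightarrow> complex) \<Rightarrow> real" where
  "L2_norm T f = sqrt (LINT t|restrict_space lborel {0<..<T}. (cmod (f t))\<^sup>2)"

definition corr_operator ::
    "(real \<Rightarrow> complex) \<Rightarrow> real \<Rightarrow> (real \<Rightarrow> complex) \<Rightarrow> real \<Rightarrow> complex" where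
  "corr_operator b T f t = (CLINT s|restrict_space lborel {0<..<T}. b (t - s) * f s)"

text \<open>The analogue of \<^const>\<open>onorm\<close> on this carrier; as there, the quotient is \<open>0\<close> when
  \<open>f\<close> has norm \<open>0\<close>.\<close>

definition L2_onorm :: "real \<Rightarrow> ((real \<Rightarrow> complex) \<Rightarrow> real \<Rightarrow> complex) \<Rightarrow> real" where
  "L2_onorm T A = (SUP f\<in>L2_space T. L2_norm T (A f) / L2_norm T f)"

end

theory Submission
  imports Defs
begin

text \<open>
  Let \<open>\<mu>\<close> be the Stieltjes measure of \<open>\<theta>\<close>, so that \<open>b\<close> is the Fourier transform of \<open>\<mu>\<close>, and write
  \<open>F(\<lambda>) = \<integral> e\<^sup>-\<^sup>i\<^sup>\<lambda>\<^sup>s f(s) ds\<close> for the Fourier integral of \<open>f\<close> over \<open>(0,T)\<close>. Inserting the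
  spectral representation of \<open>b\<close> and exchanging integrals gives
  \<open>\<langle>B\<^sub>T f, g\<rangle> = \<integral> F G\<^sup>* d\<mu>\<close>. In operator terms, \<open>B\<^sub>T\<close> is \<open>C C\<^sup>*\<close>, where \<open>C\<^sup>* f = F\<close> maps
  \<open>L\<^sub>2(0,T)\<close> to \<open>L\<^sub>2(\<mu>)\<close>, and it has the same norm as \<open>C\<^sup>* C\<close>, the integral operator on \<open>L\<^sub>2(\<mu>)\<close>
  with the kernel \<open>D\<^sub>T(\<lambda>' - \<lambda>)\<close>, where \<open>D\<^sub>T(x) = \<integral> e\<^sup>i\<^sup>x\<^sup>t dt\<close> over \<open>(0,T)\<close>. This kernel has size \<open>T\<close>
  at \<open>0\<close> and decays like \<open>2/\<bar>x\<bar>\<close>, so after division by \<open>T\<close> it concentrates on the diagonal and only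
  sees the atoms of \<open>\<mu>\<close>.

  Precisely, two estimates hold for every \<open>T > 0\<close>. From below, testing with \<open>f(t) = e\<^sup>i\<^sup>x\<^sup>t\<close> gives
  \<open>\<parallel>B\<^sub>T\<parallel> \<ge> T \<mu>{x}\<close> (\<open>L2_onorm_corr_operator_ge_atom\<close>). From above, the Schur test
  (\<open>schur_test\<close>) gives \<open>\<parallel>B\<^sub>T\<parallel> \<le> sup\<^sub>\<lambda> \<integral> \<bar>D\<^sub>T(\<lambda>' - \<lambda>)\<bar> d\<mu>(\<lambda>')\<close>, and splitting this integral at distance
  \<open>d\<close> from \<open>\<lambda>\<close> bounds it by \<open>T sup\<^sub>\<lambda> \<mu>[\<lambda>-d,\<lambda>+d] + (2/d) \<mu>(\<real>)\<close>
  (\<open>dirichlet_window_integral_le\<close>). By compactness the masses of short intervals are uniformly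
  almost bounded by the largest atom (\<open>uniformly_small_intervals\<close>), so \<open>\<parallel>B\<^sub>T\<parallel>/T\<close> tends to the largest
  atom mass (\<open>L2_onorm_corr_operator_tendsto\<close>).

  The atom of \<open>\<mu>\<close> at a point is the jump of \<open>\<theta>\<close> there, and \<open>\<theta>\<close> is continuous exactly where the
  jump is zero. Hence the limit is \<open>0\<close> if and only if \<open>\<theta>\<close> is continuous, and otherwise it is the largest
  jump. Stability asks for some continuous spectral function: if the limit is \<open>0\<close>, then \<open>\<theta>\<close> itself is
  one; conversely, the limit theorem applies to the spectral function that stability provides, because the
  norms depend on \<open>b\<close> alone.
\<close>

section \<open>One-sided limits and the Stieltjes measure of a monotone function\<close>

lemma mono_tendsto_at_right:
  fixes \<theta> :: "real \<Rightarrow> real"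
  assumes "mono \<theta>"
  shows "(\<theta> \<longlongrightarrow> Lim (at_right x) \<theta>) (at_right x)"
proof -
  have "(\<theta> \<longlongrightarrow> Inf (\<theta> ` ({x<..} \<inter> UNIV))) (at x within ({x<..} \<inter> UNIV))"
    by (rule Lim_right_bound[where K = "\<theta> x"]) (auto intro: monoD[OF assms])
  then have lim: "(\<theta> \<longlongrightarrow> Inf (\<theta> ` {x<..})) (at_right x)" by simp
  with tendsto_Lim[OF _ lim] show ?thesis by simp
qed

lemma mono_tendsto_at_left:
  fixes \<theta> :: "real \<Rightarrow> real"
  assumes "mono \<theta>"
  shows "(\<theta> \<longlongrightarrow> Lim (at_left x) \<theta>) (at_left x)"
proof -
  have "(\<theta> \<longlongrightarrow> Sup (\<theta> ` ({..<x} \<inter> UNIV))) (at x within ({..<x} \<inter> UNIV))"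
    by (rule Lim_left_bound[where K = "\<theta> x"]) (auto intro: monoD[OF assms])
  then have lim: "(\<theta> \<longlongrightarrow> Sup (\<theta> ` {..<x})) (at_left x)" by simp
  with tendsto_Lim[OF _ lim] show ?thesis by simp
qed

lemma le_right_limit:
  fixes \<theta> :: "real \<Rightarrow> real"
  assumes "mono \<theta>"
  shows "\<theta> x \<le> Lim (at_right x) \<theta>"
  by (rule tendsto_lowerbound[OF mono_tendsto_at_right[OF assms]])
     (auto simp: eventually_at_filter intro!: monoD[OF assms] always_eventually)

lemma right_limit_le:
  fixes \<theta> :: "real \<Rightarrow> real"
  assumes "mono \<theta>" "x < y"
  shows "Lim (at_right x) \<theta> \<le> \<theta> y"
  by (intro tendsto_upperbound[OF mono_tendsto_at_right[OF assms(1)]])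
     (auto intro!: monoD[OF assms(1)] eventually_at_rightI[OF _ assms(2)])

lemma left_limit_le:
  fixes \<theta> :: "real \<Rightarrow> real"
  assumes "mono \<theta>"
  shows "Lim (at_left x) \<theta> \<le> \<theta> x"
  by (rule tendsto_upperbound[OF mono_tendsto_at_left[OF assms]])
     (auto simp: eventually_at_filter intro!: monoD[OF assms] always_eventually)

lemma le_left_limit:
  fixes \<theta> :: "real \<Rightarrow> real"
  assumes "mono \<theta>" "y < x"
  shows "\<theta> y \<le> Lim (at_left x) \<theta>"
  by (intro tendsto_lowerbound[OF mono_tendsto_at_left[OF assms(1)]])
     (auto intro!: monoD[OF assms(1)] eventually_at_leftI[OF _ assms(2)])

lemma right_limit_mono:
  fixes \<theta> :: "real \<Rightarrow> real"
  assumes "mono \<theta>" "x \<le> y"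
  shows "Lim (at_right x) \<theta> \<le> Lim (at_right y) \<theta>"
proof (cases "x = y")
  case False
  then show ?thesis
    using right_limit_le[OF assms(1), of x y] le_right_limit[OF assms(1), of y] assms(2) by simp
qed simp

text \<open>Right-continuity is what makes \<^const>\<open>interval_measure\<close> give the
  half-open intervals their expected masses.\<close>

lemma continuous_right_limit:
  fixes \<theta> :: "real \<Rightarrow> real"
  assumes "mono \<theta>"
  shows "continuous (at_right x) (\<lambda>x. Lim (at_right x) \<theta>)"
  unfolding continuous_within
proof (rule order_tendstoI)
  fix a assume "a < Lim (at_right x) \<theta>"
  then show "\<forall>\<^sub>F y in at_right x. a < Lim (at_right y) \<theta>"
    using right_limit_mono[OF assms, of x]
    by (intro eventually_at_rightI[of x "x + 1"]) (auto intro: less_le_trans)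
next
  fix a assume "Lim (at_right x) \<theta> < a"
  then have "\<forall>\<^sub>F y in at_right x. \<theta> y < a"
    by (rule order_tendstoD[OF mono_tendsto_at_right[OF assms]])
  then obtain c where c: "x < c" "\<And>y. x < y \<Longrightarrow> y < c \<Longrightarrow> \<theta> y < a"
    unfolding eventually_at_right_field by auto
  show "\<forall>\<^sub>F y in at_right x. Lim (at_right y) \<theta> < a"
  proof (rule eventually_at_rightI)
    fix y assume y: "y \<in> {x<..<c}"
    have "Lim (at_right y) \<theta> \<le> \<theta> ((y + c) / 2)" using y by (intro right_limit_le assms) auto
    also have "\<dots> < a" using y by (intro c) auto
    finally show "Lim (at_right y) \<theta> < a" .
  qed fact
qed

lemma isCont_iff_no_jump:
  fixes \<theta> :: "real \<Rightarrow> real"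
  assumes "mono \<theta>"
  shows "isCont \<theta> x \<longleftrightarrow> Lim (at_right x) \<theta> = Lim (at_left x) \<theta>"
proof
  assume "isCont \<theta> x"
  then have "(\<theta> \<longlongrightarrow> \<theta> x) (at_right x)" "(\<theta> \<longlongrightarrow> \<theta> x) (at_left x)"
    by (auto simp: isCont_def filterlim_at_split)
  then have "Lim (at_right x) \<theta> = \<theta> x" "Lim (at_left x) \<theta> = \<theta> x"
    by (auto intro!: tendsto_Lim)
  then show "Lim (at_right x) \<theta> = Lim (at_left x) \<theta>" by simp
next
  assume "Lim (at_right x) \<theta> = Lim (at_left x) \<theta>"
  then have "Lim (at_right x) \<theta> = \<theta> x" "Lim (at_left x) \<theta> = \<theta> x"
    using le_right_limit[OF assms, of x] left_limit_le[OF assms, of x] by auto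
  then show "isCont \<theta> x"
    using mono_tendsto_at_right[OF assms, of x] mono_tendsto_at_left[OF assms, of x]
    by (auto simp: isCont_def filterlim_at_split)
qed

lemma finite_borel_measure_stieltjes:
  assumes "mono \<theta>" "bounded (range \<theta>)"
  shows "finite_borel_measure (stieltjes_measure \<theta>)"
proof -
  let ?g = "\<lambda>x. Lim (at_right x) \<theta>"
  from assms(2) obtain K where K: "\<And>x. \<bar>\<theta> x\<bar> \<le> K" by (auto simp: bounded_iff)
  have Ioc: "emeasure (stieltjes_measure \<theta>) {-real n<..real n} \<le> ennreal (2 * K)" for n :: nat
  proof -
    have "?g (real n) \<le> K" using right_limit_le[OF assms(1), of "real n" "real n + 1"] K[of "real n + 1"]
      by simp
    moreover have "- K \<le> ?g (- real n)" using le_right_limit[OF assms(1), of "- real n"] K[of "- real n"]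
      by simp
    ultimately show ?thesis
      unfolding stieltjes_measure_def
      by (subst emeasure_interval_measure_Ioc)
         (auto intro!: right_limit_mono continuous_right_limit assms ennreal_leI)
  qed
  have UN: "(\<Union>n. {-real n<..real n}) = UNIV"
  proof -
    have "\<exists>n. - real n < x \<and> x \<le> real n" for x :: real
      proof -
      obtain n where "\<bar>x\<bar> < real n" using reals_Archimedean2 by blast
      then have "- real n < x \<and> x \<le> real n" by linarith
      then show ?thesis by blast
    qed
    then show ?thesis by (simp add: set_eq_iff)
  qed
  have "emeasure (stieltjes_measure \<theta>) UNIV = (SUP n. emeasure (stieltjes_measure \<theta>) {-real n<..real n})"
    by (subst SUP_emeasure_incseq) (auto simp: UN stieltjes_measure_def incseq_def)
  also have "\<dots> \<le> ennreal (2 * K)" by (intro SUP_least Ioc)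
  also have "\<dots> < \<infinity>" by simp
  finally have "emeasure (stieltjes_measure \<theta>) UNIV \<noteq> \<infinity>" by simp
  moreover have "sets (stieltjes_measure \<theta>) = sets borel" "space (stieltjes_measure \<theta>) = UNIV"
    by (simp_all add: stieltjes_measure_def)
  ultimately show ?thesis
    by (intro finite_borel_measure.intro finite_measureI finite_borel_measure_axioms.intro) simp_all
qed

text \<open>Although the measure is built from \<open>\<theta>(x+0)\<close>, the left limit of that
  function is again \<open>\<theta>(x-0)\<close>, because
  \<open>\<theta>(y) \<le> \<theta>(y+0) \<le> \<theta>(x-0)\<close> for
  \<open>y < x\<close>.\<close>

lemma measure_stieltjes_singleton:
  assumes "mono \<theta>" "bounded (range \<theta>)"
  shows "measure (stieltjes_measure \<theta>) {x} = Lim (at_right x) \<theta> - Lim (at_left x) \<theta>"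
proof -
  interpret finite_borel_measure "stieltjes_measure \<theta>"
    by (rule finite_borel_measure_stieltjes[OF assms])
  let ?g = "\<lambda>x. Lim (at_right x) \<theta>" and ?a = "\<lambda>n. x - inverse (real (Suc n))"
  have a_lim: "filterlim ?a (at_left x) sequentially"
    unfolding filterlim_at
    using tendsto_diff[OF tendsto_const[of x] LIMSEQ_inverse_real_of_nat] by auto
  have "(\<lambda>n. measure (stieltjes_measure \<theta>) {?a n<..x}) \<longlonglongrightarrow> measure (stieltjes_measure \<theta>) (\<Inter>n. {?a n<..x})"
  proof (rule finite_Lim_measure_decseq)
    show "decseq (\<lambda>n. {?a n<..x})"
    proof (rule decseq_SucI)
      fix n
      have "inverse (real (Suc (Suc n))) \<le> inverse (real (Suc n))" by (intro le_imp_inverse_le) auto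
      then show "{?a (Suc n)<..x} \<subseteq> {?a n<..x}" by (simp add: Ioc_subset_iff del: of_nat_Suc)
    qed
  qed auto
  also have "(\<Inter>n. {?a n<..x}) = {x}"
  proof -
    have "y = x" if y: "\<And>n. ?a n < y" "y \<le> x" for y
    proof (rule antisym[OF y(2)])
      have "?a \<longlonglongrightarrow> x" using a_lim by (simp add: filterlim_at)
      then show "x \<le> y" by (rule LIMSEQ_le_const2) (use y(1) in \<open>auto intro!: less_imp_le\<close>)
    qed
    then show ?thesis by auto
  qed
  also have "(\<lambda>n. measure (stieltjes_measure \<theta>) {?a n<..x}) = (\<lambda>n. ?g x - ?g (?a n))"
    unfolding stieltjes_measure_def
    by (intro ext, subst measure_interval_measure_Ioc)
       (auto intro!: right_limit_mono continuous_right_limit assms)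
  finally have "(\<lambda>n. ?g x - ?g (?a n)) \<longlonglongrightarrow> measure (stieltjes_measure \<theta>) {x}" .
  moreover have "(\<lambda>n. ?g (?a n)) \<longlonglongrightarrow> Lim (at_left x) \<theta>"
  proof (rule tendsto_sandwich[OF always_eventually always_eventually])
    show "\<forall>n. \<theta> (?a n) \<le> ?g (?a n)" using le_right_limit[OF assms(1)] by blast
    show "(\<lambda>n. \<theta> (?a n)) \<longlonglongrightarrow> Lim (at_left x) \<theta>"
      by (rule filterlim_compose[OF mono_tendsto_at_left[OF assms(1)] a_lim])
    show "\<forall>n. ?g (?a n) \<le> Lim (at_left x) \<theta>"
    proof
      fix n
      let ?y = "(?a n + x) / 2"
      have "inverse (real (Suc n)) > 0" by simp
      then have "?a n < ?y" "?y < x" by (simp_all only: field_simps) auto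
      then show "?g (?a n) \<le> Lim (at_left x) \<theta>"
        using right_limit_le[OF assms(1)] le_left_limit[OF assms(1)] order_trans by blast
    qed
  qed (rule tendsto_const)
  then have "(\<lambda>n. ?g x - ?g (?a n)) \<longlonglongrightarrow> ?g x - Lim (at_left x) \<theta>" by (intro tendsto_intros)
  ultimately show ?thesis by (rule LIMSEQ_unique)
qed

section \<open>Atoms of a finite Borel measure on the line\<close>

context finite_borel_measure
begin

lemma finite_heavy_atoms:
  assumes "e > 0"
  shows "finite {x. e \<le> measure M {x}}"
proof (rule ccontr)
  assume "infinite {x. e \<le> measure M {x}}"
  define n where "n = nat \<lceil>measure M UNIV / e\<rceil> + 1"
  obtain X where X: "X \<subseteq> {x. e \<le> measure M {x}}" "finite X" "card X = n"
    using infinite_arbitrarily_large[OF \<open>infinite _\<close>] by blast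
  have "real n * e \<le> (\<Sum>x\<in>X. measure M {x})"
    using sum_bounded_below[of X e "\<lambda>x. measure M {x}"] X by auto
  also have "\<dots> = measure M X"
    using X by (intro finite_measure_eq_sum_singleton[symmetric]) auto
  also have "\<dots> \<le> measure M UNIV" by (intro finite_measure_mono) auto
  finally have "real n \<le> measure M UNIV / e" using assms by (simp add: field_simps)
  moreover have "measure M UNIV / e < real n" unfolding n_def by linarith
  ultimately show False by simp
qed

text \<open>The supremum of the atom masses is attained because only finitely many atoms are at
  least as heavy as a given one.\<close>

lemma heaviest_atom:
  obtains x where "\<And>y. measure M {y} \<le> measure M {x}"
proof (cases "\<exists>z. measure M {z} > 0")
  case True
  then obtain z where z: "measure M {z} > 0" by blast
  let ?S = "{x. measure M {z} \<le> measure M {x}}"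
  have fin: "finite ?S" by (rule finite_heavy_atoms[OF z])
  have "Max ((\<lambda>x. measure M {x}) ` ?S) \<in> (\<lambda>x. measure M {x}) ` ?S"
    using fin by (intro Max_in) auto
  then obtain x where x: "x \<in> ?S" "measure M {x} = Max ((\<lambda>x. measure M {x}) ` ?S)" by force
  have "measure M {y} \<le> measure M {x}" for y
  proof (cases "y \<in> ?S")
    case True
    then show ?thesis unfolding x(2) using fin by (intro Max_ge) auto
  next
    case False
    then show ?thesis using x(1) by simp
  qed
  then show ?thesis by (rule that)
next
  case False
  then have "measure M {y} \<le> measure M {0}" for y
    using measure_nonneg[of M "{0}"] by (meson not_le order_trans)
  then show ?thesis by (rule that)
qed

lemma small_interval_at:
  assumes "measure M {x} < c"
  shows "\<exists>r>0. measure M {x - r<..<x + r} < c"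
proof -
  let ?r = "\<lambda>n. inverse (real (Suc n))"
  have "(\<lambda>n. measure M {x - ?r n<..<x + ?r n}) \<longlonglongrightarrow> measure M (\<Inter>n. {x - ?r n<..<x + ?r n})"
  proof (rule finite_Lim_measure_decseq)
    show "decseq (\<lambda>n. {x - ?r n<..<x + ?r n})"
    proof (rule decseq_SucI)
      fix n
      have "inverse (real (Suc (Suc n))) \<le> inverse (real (Suc n))" by (intro le_imp_inverse_le) auto
      then show "{x - ?r (Suc n)<..<x + ?r (Suc n)} \<subseteq> {x - ?r n<..<x + ?r n}"
        by (intro greaterThanLessThan_subseteq_greaterThanLessThan[THEN iffD2]) linarith
    qed
  qed auto
  also have "(\<Inter>n. {x - ?r n<..<x + ?r n}) = {x}"
  proof -
    have "y = x" if y: "\<And>n. x - ?r n < y \<and> y < x + ?r n" for y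
    proof (rule ccontr)
      assume "y \<noteq> x"
      then have "0 < \<bar>y - x\<bar>" by simp
      then obtain n where "?r n < \<bar>y - x\<bar>" using reals_Archimedean by blast
      then show False using y[of n] by linarith
    qed
    then show ?thesis by auto
  qed
  finally have "\<forall>\<^sub>F n in sequentially. measure M {x - ?r n<..<x + ?r n} < c"
    by (rule order_tendstoD(2)) fact
  then obtain n where "measure M {x - ?r n<..<x + ?r n} < c"
    by (auto simp: eventually_sequentially)
  moreover have "?r n > 0" by simp
  ultimately show ?thesis by blast
qed

text \<open>Each point has a neighbourhood of mass below \<open>c\<close>. A Lebesgue number of this
  cover of a large compact interval gives a common radius there, and beyond that interval almost no
  mass is left.\<close>

lemma uniformly_small_intervals:
  assumes atoms: "\<And>x. measure M {x} < c"
  shows "\<exists>d>0. \<forall>x. measure M {x - d..x + d} \<le> c"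
proof -
  have "0 < c" using atoms[of 0] measure_nonneg[of M "{0}"] by linarith
  \<comment> \<open>Outside \<open>[-R,R]\<close> less than \<open>c\<close> is left, which needs \<open>c > 0\<close>.\<close>
  obtain R where R: "measure M (- {- R..R}) < c"
  proof -
    have "(\<lambda>n. measure M (- {- real n..real n})) \<longlonglongrightarrow> measure M (\<Inter>n. - {- real n..real n})"
      by (rule finite_Lim_measure_decseq) (auto simp: decseq_def)
    also have "(\<Inter>n. - {- real n..real n}) = {}"
    proof -
      have "\<exists>n. - real n \<le> x \<and> x \<le> real n" for x :: real
        proof -
        obtain n where "\<bar>x\<bar> \<le> real n" using real_arch_simple by blast
        then have "- real n \<le> x \<and> x \<le> real n" by linarith
        then show ?thesis by blast
      qed
      then show ?thesis by (simp add: set_eq_iff)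
    qed
    finally have "\<forall>\<^sub>F n in sequentially. measure M (- {- real n..real n}) < c"
      by (rule order_tendstoD(2)) (simp add: \<open>0 < c\<close>)
    then show ?thesis using that by (auto simp: eventually_sequentially)
  qed
  define G where "G = {{x - r<..<x + r} | x r. r > 0 \<and> measure M {x - r<..<x + r} < c}"
  obtain e where e: "e > 0" "\<And>x. x \<in> {- R - 1..R + 1} \<Longrightarrow> \<exists>U\<in>G. ball x e \<subseteq> U"
  proof (rule Heine_Borel_lemma[of "{- R - 1..R + 1}" G])
    show "{- R - 1..R + 1} \<subseteq> \<Union>G"
    proof
      fix x
      obtain r where "r > 0" "measure M {x - r<..<x + r} < c"
        using small_interval_at[OF atoms] by blast
      then have "{x - r<..<x + r} \<in> G" "x \<in> {x - r<..<x + r}" unfolding G_def by auto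
      then show "x \<in> \<Union>G" by blast
    qed
  qed (auto simp: G_def)
  \<comment> \<open>A radius below \<open>1\<close> keeps an interval centred outside \<open>[-R-1,R+1]\<close> disjoint from \<open>[-R,R]\<close>.\<close>
  define d where "d = min (1/2) (e / 2)"
  have d: "d > 0" "d < e" "d < 1" using e(1) by (auto simp: d_def min_def)
  have "measure M {x - d..x + d} \<le> c" for x
  proof (cases "x \<in> {- R - 1..R + 1}")
    case True
    then obtain U where U: "U \<in> G" "ball x e \<subseteq> U" using e(2) by blast
    have "{x - d..x + d} \<subseteq> ball x e" using d by (auto simp: dist_real_def)
    then have "{x - d..x + d} \<subseteq> U" using U by blast
    moreover have "measure M U < c" "U \<in> sets M" using U by (auto simp: G_def)
    ultimately show ?thesis using finite_measure_mono[of "{x - d..x + d}" U] by simp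
  next
    case False
    then have "{x - d..x + d} \<subseteq> - {- R..R}" using d by auto
    then have "measure M {x - d..x + d} \<le> measure M (- {- R..R})"
      by (rule finite_measure_mono) auto
    then show ?thesis using R by simp
  qed
  with d(1) show ?thesis by blast
qed

end

section \<open>Fourier integrals over a finite window\<close>

abbreviation window :: "real \<Rightarrow> real measure" where
  "window T \<equiv> restrict_space lborel {0<..<T}"

definition fourier_window :: "real \<Rightarrow> (real \<Rightarrow> complex) \<Rightarrow> real \<Rightarrow> complex" where
  "fourier_window T f l = (CLINT s|window T. iexp (- (l * s)) * f s)"

text \<open>For \<open>T > 0\<close> this is the Dirichlet kernel of the window,
  \<open>(e\<^sup>i\<^sup>x\<^sup>T - 1)/(ix)\<close> for \<open>x \<noteq> 0\<close>; its value
  at \<open>0\<close> is \<open>T\<close>.\<close>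

definition dirichlet_window :: "real \<Rightarrow> real \<Rightarrow> complex" where
  "dirichlet_window T x = (CLINT t|window T. iexp (x * t))"

lemma finite_measure_window: "finite_measure (window T)"
  by (cases "0 < T")
     (auto intro!: finite_measureI simp: space_restrict_space emeasure_restrict_space)


lemma integral_window_const: "T > 0 \<Longrightarrow> (LINT t|window T. (c::real)) = c * T"
  by (simp add: integral_restrict_space measure_restrict_space space_restrict_space)

lemma pair_integrable_mult:
  fixes f g :: "real \<Rightarrow> complex"
  assumes "finite_measure A" "finite_measure B" and f: "integrable A f" and g: "integrable B g"
  shows "integrable (A \<Otimes>\<^sub>M B) (\<lambda>(x, y). f x * g y)"
proof -
  interpret A: finite_measure A by fact
  interpret B: finite_measure B by fact
  interpret P: pair_sigma_finite A B ..
  have [measurable]: "f \<in> borel_measurable A" "g \<in> borel_measurable B" using f g by auto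
  show ?thesis
    by (rule P.Fubini_integrable)
       (use f g in \<open>auto simp: norm_mult\<close>)
qed

lemma cmod_dirichlet_window_le:
  assumes "T > 0"
  shows "cmod (dirichlet_window T x) \<le> T"
proof -
  have "cmod (dirichlet_window T x) \<le> (LINT t|window T. cmod (iexp (x * t)))"
    unfolding dirichlet_window_def by (rule integral_norm_bound)
  also have "\<dots> = T" using integral_window_const[OF assms, of 1] by simp
  finally show ?thesis .
qed

lemma cmod_dirichlet_window_decay:
  assumes "T > 0" "x \<noteq> 0"
  shows "cmod (dirichlet_window T x) \<le> 2 / \<bar>x\<bar>"
proof -
  have "dirichlet_window T x = (CLBINT t:{0<..<T}. iexp (x * t))"
    unfolding dirichlet_window_def set_lebesgue_integral_def by (subst integral_restrict_space) auto
  also have "\<dots> = (CLBINT t=ereal 0..ereal T. iexp (x * t))"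
    using assms by (subst interval_integral_Ioo) auto
  also have "\<dots> = iexp (x * T) / (\<i> * x) - iexp (x * 0) / (\<i> * x)"
  proof (rule interval_integral_FTC_finite)
    fix t
    have "((\<lambda>z. exp (\<i> * (complex_of_real x * z)) / (\<i> * x)) has_field_derivative iexp (x * t))
        (at (complex_of_real t))"
      using assms by (auto intro!: derivative_eq_intros simp: algebra_simps)
    from has_vector_derivative_real_field[OF this]
    show "((\<lambda>t. iexp (x * t) / (\<i> * x)) has_vector_derivative iexp (x * t))
        (at t within {min 0 T..max 0 T})" by simp
  qed (intro continuous_intros)
  also have "cmod \<dots> \<le> cmod (iexp (x * T) / (\<i> * x)) + cmod (iexp (x * 0) / (\<i> * x))"
    by (rule norm_triangle_ineq4)
  also have "\<dots> = 2 / \<bar>x\<bar>" by (simp add: norm_divide norm_mult)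
  finally show ?thesis .
qed

lemma cmod_dirichlet_window_uminus: "cmod (dirichlet_window T (- x)) = cmod (dirichlet_window T x)"
proof -
  have "dirichlet_window T (- x) = (CLINT t|window T. cnj (iexp (x * t)))"
    unfolding dirichlet_window_def by (simp add: exp_cnj)
  also have "\<dots> = cnj (dirichlet_window T x)"
    unfolding dirichlet_window_def by (rule Bochner_Integration.integral_cnj)
  finally show ?thesis by simp
qed

lemma measurable_dirichlet_window [measurable]: "dirichlet_window T \<in> borel_measurable borel"
proof -
  interpret finite_measure "window T" by (rule finite_measure_window)
  have [measurable]: "(\<lambda>t. t) \<in> borel_measurable (window T)"
    by (auto intro: measurable_restrict_space1)
  show ?thesis unfolding dirichlet_window_def[abs_def] by measurable
qed

lemma integrable_L2_space:
  assumes "f \<in> L2_space T"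
  shows "integrable (window T) f"
proof -
  interpret finite_measure "window T" by (rule finite_measure_window)
  have "integrable (window T) (\<lambda>t. cmod (f t))"
    by (rule square_integrable_imp_integrable) (use assms in \<open>auto simp: L2_space_def\<close>)
  moreover have "f \<in> borel_measurable (window T)" using assms by (simp add: L2_space_def)
  ultimately show ?thesis by (simp add: integrable_norm_iff)
qed

lemma measurable_id_window [measurable]: "(\<lambda>t. t) \<in> borel_measurable (window T)"
  by (auto intro: measurable_restrict_space1)

lemma measurable_fourier_window [measurable]:
  assumes [measurable]: "f \<in> borel_measurable (window T)"
  shows "fourier_window T f \<in> borel_measurable borel"
proof -
  interpret finite_measure "window T" by (rule finite_measure_window)
  show ?thesis unfolding fourier_window_def[abs_def] by measurable
qed

lemma cmod_fourier_window_le: "cmod (fourier_window T f l) \<le> (LINT s|window T. cmod (f s))"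
proof -
  have "cmod (fourier_window T f l) \<le> (LINT s|window T. cmod (iexp (- (l * s)) * f s))"
    unfolding fourier_window_def by (rule integral_norm_bound)
  also have "\<dots> = (LINT s|window T. cmod (f s))"
    by (intro Bochner_Integration.integral_cong refl) (simp add: norm_mult)
  finally show ?thesis .
qed

context finite_borel_measure
begin

lemma integrable_fourier_window:
  assumes "integrable (window T) f"
  shows "integrable M (fourier_window T f)"
proof (rule integrable_const_bound)
  show "AE l in M. cmod (fourier_window T f l) \<le> (LINT s|window T. cmod (f s))"
    using cmod_fourier_window_le by simp
  show "fourier_window T f \<in> borel_measurable M"
    using assms by (subst measurable_cong_sets[OF M_is_borel refl]) auto
qed

lemma integrable_fourier_window_sq:
  assumes "integrable (window T) f"
  shows "integrable M (\<lambda>l. (cmod (fourier_window T f l))\<^sup>2)"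
proof (rule integrable_const_bound)
  note [measurable] = borel_measurable_integrable[OF integrable_fourier_window[OF assms]]
  show "AE l in M. norm ((cmod (fourier_window T f l))\<^sup>2) \<le> (LINT s|window T. cmod (f s))\<^sup>2"
    using cmod_fourier_window_le by (auto intro!: AE_I2 power_mono)
  show "(\<lambda>l. (cmod (fourier_window T f l))\<^sup>2) \<in> borel_measurable M" by measurable
qed

text \<open>The one use of Fubini's theorem for the operator: the frequency \<open>l\<close> and the
  time \<open>s\<close> are coupled only through a unimodular factor, so integrability of
  \<open>\<phi>\<close> and \<open>\<psi>\<close> suffices. The sign \<open>c\<close> is
  \<open>-1\<close> when the spectral representation of \<open>b(t-s)\<close> is inserted and
  \<open>1\<close> when \<open>B\<^sub>T f\<close> is tested against a function.\<close>

lemma fourier_exchange: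
  fixes \<phi> \<psi> :: "real \<Rightarrow> complex"
  assumes \<phi>: "integrable M \<phi>" and \<psi>: "integrable (window T) \<psi>"
  shows "(CLINT s|window T. (CLINT l|M. iexp (c * l * s) * \<phi> l) * \<psi> s) =
         (CLINT l|M. \<phi> l * (CLINT s|window T. iexp (c * l * s) * \<psi> s))"
proof -
  interpret N: finite_measure "window T" by (rule finite_measure_window)
  interpret P: pair_sigma_finite M "window T" ..
  note [measurable] = borel_measurable_integrable[OF \<phi>] borel_measurable_integrable[OF \<psi>]
  have [measurable]: "(\<lambda>l. l) \<in> borel_measurable M"
    by (subst measurable_cong_sets[OF M_is_borel refl]) simp
  have int: "integrable (M \<Otimes>\<^sub>M window T) (\<lambda>(l, s). iexp (c * l * s) * (\<phi> l * \<psi> s))"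
  proof (rule Bochner_Integration.integrable_bound)
    show "integrable (M \<Otimes>\<^sub>M window T) (\<lambda>(l, s). \<phi> l * \<psi> s)"
      by (rule pair_integrable_mult[OF finite_measure_axioms N.finite_measure_axioms \<phi> \<psi>])
    show "(\<lambda>(l, s). iexp (c * l * s) * (\<phi> l * \<psi> s)) \<in> borel_measurable (M \<Otimes>\<^sub>M window T)"
      by measurable
  qed (auto simp: norm_mult)
  have "(CLINT s|window T. (CLINT l|M. iexp (c * l * s) * \<phi> l) * \<psi> s) =
      (CLINT s|window T. (CLINT l|M. iexp (c * l * s) * (\<phi> l * \<psi> s)))"
    by (subst Bochner_Integration.integral_mult_left_zero[symmetric]) (simp add: mult_ac)
  also have "\<dots> = (CLINT l|M. (CLINT s|window T. iexp (c * l * s) * (\<phi> l * \<psi> s)))"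
    by (rule P.Fubini_integral[OF int])
  also have "\<dots> = (CLINT l|M. \<phi> l * (CLINT s|window T. iexp (c * l * s) * \<psi> s))"
    by (subst Bochner_Integration.integral_mult_right_zero[symmetric]) (simp add: mult_ac)
  finally show ?thesis .
qed

end

section \<open>The correlation operator in terms of Fourier integrals\<close>

locale spectral_correlation = finite_borel_measure M for M :: "real measure" +
  fixes b :: "real \<Rightarrow> complex"
  assumes b_eq: "b t = (CLINT l|M. iexp (l * t))"
begin

lemma corr_operator_eq:
  assumes "integrable (window T) f"
  shows "corr_operator b T f t = (CLINT l|M. iexp (l * t) * fourier_window T f l)"
proof -
  have [measurable]: "(\<lambda>l. l) \<in> borel_measurable M"
    by (subst measurable_cong_sets[OF M_is_borel refl]) simp
  have "integrable M (\<lambda>l. iexp (l * t))"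
    by (rule integrable_const_bound[where B = 1]) auto
  from fourier_exchange[OF this assms, of "-1"] show ?thesis
    unfolding corr_operator_def fourier_window_def b_eq
    by (simp add: exp_add[symmetric] algebra_simps)
qed

text \<open>The factorisation \<open>B\<^sub>T = C C\<^sup>*\<close> with
  \<open>C\<^sup>* f\<close> the Fourier integral of \<open>f\<close>; for \<open>g = f\<close>
  it shows that \<open>B\<^sub>T\<close> is positive.\<close>

lemma corr_operator_inner:
  assumes f: "integrable (window T) f" and g: "integrable (window T) g"
  shows "(CLINT t|window T. corr_operator b T f t * cnj (g t)) =
         (CLINT l|M. fourier_window T f l * cnj (fourier_window T g l))"
proof -
  have cnj_int: "integrable (window T) (\<lambda>t. cnj (g t))" using g by simp
  have "(CLINT s|window T. iexp (l * s) * cnj (g s)) = cnj (fourier_window T g l)" for l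
    unfolding fourier_window_def
    by (subst Bochner_Integration.integral_cnj[symmetric]) (simp add: exp_cnj)
  with fourier_exchange[OF integrable_fourier_window[OF f] cnj_int, of 1] show ?thesis
    by (simp add: corr_operator_eq[OF f])
qed

text \<open>The intertwining relation
  \<open>C\<^sup>* (C C\<^sup>*) = (C\<^sup>* C) C\<^sup>*\<close>, where
  \<open>C\<^sup>* C\<close> has the Dirichlet kernel on \<open>L\<^sub>2(\<mu>)\<close>.\<close>

lemma fourier_window_corr_operator:
  assumes f: "integrable (window T) f"
  shows "fourier_window T (corr_operator b T f) l =
         (CLINT k|M. fourier_window T f k * dirichlet_window T (k - l))"
proof -
  interpret N: finite_measure "window T" by (rule finite_measure_window)
  have "integrable (window T) (\<lambda>s. iexp (- (l * s)))"
    by (rule N.integrable_const_bound[where B = 1]) auto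
  from fourier_exchange[OF integrable_fourier_window[OF f] this, of 1] show ?thesis
    unfolding dirichlet_window_def
    by (simp add: corr_operator_eq[OF f] fourier_window_def[of T "corr_operator b T f"] exp_add[symmetric] algebra_simps)
qed

lemma cmod_corr_operator_le:
  assumes f: "integrable (window T) f"
  shows "cmod (corr_operator b T f t) \<le> (LINT s|window T. cmod (f s)) * measure M UNIV"
proof -
  have "cmod (corr_operator b T f t) \<le> (LINT l|M. cmod (iexp (l * t) * fourier_window T f l))"
    unfolding corr_operator_eq[OF f] by (rule integral_norm_bound)
  also have "\<dots> \<le> (LINT l|M. (LINT s|window T. cmod (f s)))"
    using integrable_fourier_window[OF f] cmod_fourier_window_le
    by (intro integral_mono) (auto simp: norm_mult)
  also have "\<dots> = (LINT s|window T. cmod (f s)) * measure M UNIV"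
    by (simp add: borel_UNIV)
  finally show ?thesis .
qed

lemma corr_operator_L2_space:
  assumes "f \<in> L2_space T"
  shows "corr_operator b T f \<in> L2_space T"
proof -
  interpret N: finite_measure "window T" by (rule finite_measure_window)
  note f = integrable_L2_space[OF assms]
  note [measurable] = borel_measurable_integrable[OF integrable_fourier_window[OF f]]
  have [measurable]: "(\<lambda>l. l) \<in> borel_measurable M"
    by (subst measurable_cong_sets[OF M_is_borel refl]) simp
  have "corr_operator b T f \<in> borel_measurable (window T)"
    unfolding corr_operator_eq[OF f, abs_def] by measurable
  moreover from this have "integrable (window T) (\<lambda>t. (cmod (corr_operator b T f t))\<^sup>2)"
    using cmod_corr_operator_le[OF f]
    by (intro N.integrable_const_bound[where B = "((LINT s|window T. cmod (f s)) * measure M UNIV)\<^sup>2"])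
       (auto intro!: power_mono)
  ultimately show ?thesis by (simp add: L2_space_def)
qed

end

section \<open>The upper bound by the Schur test\<close>

text \<open>For a symmetric kernel,
  \<open>u(x) u(y) \<le> (u(x)\<^sup>2 + u(y)\<^sup>2)/2\<close> reduces the quadratic form to
  two equal integrals of \<open>u(x)\<^sup>2 k(x,y)\<close>, in which the row integrals can be
  carried out first.\<close>

lemma schur_test:
  fixes M :: "'a measure" and u :: "'a \<Rightarrow> real" and k :: "'a \<Rightarrow> 'a \<Rightarrow> real"
  assumes "finite_measure M"
    and [measurable]: "u \<in> borel_measurable M" "(\<lambda>(x, y). k x y) \<in> borel_measurable (M \<Otimes>\<^sub>M M)"
    and u: "\<And>x. 0 \<le> u x" "\<And>x. u x \<le> B"
    and k: "\<And>x y. 0 \<le> k x y" "\<And>x y. k x y \<le> C" "\<And>x y. k x y = k y x"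
    and S: "\<And>x. (LINT y|M. k x y) \<le> S"
  shows "(LINT x|M. u x * (LINT y|M. u y * k y x)) \<le> S * (LINT x|M. (u x)\<^sup>2)"
proof -
  interpret finite_measure M by fact
  interpret P: pair_sigma_finite M M ..
  interpret PF: finite_measure "M \<Otimes>\<^sub>M M" by (rule finite_measure_pair_measure) unfold_locales
  have B: "0 \<le> B" using u order_trans by blast
  have C: "0 \<le> C" using k order_trans by blast
  have u2: "(u x)\<^sup>2 \<le> B\<^sup>2" for x using u by (intro power_mono)
  have int1: "integrable (M \<Otimes>\<^sub>M M) (\<lambda>(x, y). u x * (u y * k x y))"
  proof (rule PF.integrable_const_bound)
    show "AE z in M \<Otimes>\<^sub>M M. norm (case z of (x, y) \<Rightarrow> u x * (u y * k x y)) \<le> B * (B * C)"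
      using u k(1,2) B C
      by (intro AE_I2) (auto intro!: mult_mono mult_nonneg_nonneg simp: abs_mult)
  qed measurable
  have int2: "integrable (M \<Otimes>\<^sub>M M) (\<lambda>(x, y). (u x)\<^sup>2 * k x y)"
  proof (rule PF.integrable_const_bound)
    show "AE z in M \<Otimes>\<^sub>M M. norm (case z of (x, y) \<Rightarrow> (u x)\<^sup>2 * k x y) \<le> B\<^sup>2 * C"
      using u2 k(1,2) B C
      by (intro AE_I2) (auto intro!: mult_mono mult_nonneg_nonneg simp: abs_mult)
  qed measurable
  have int3: "integrable (M \<Otimes>\<^sub>M M) (\<lambda>(x, y). (u y)\<^sup>2 * k x y)"
  proof (rule PF.integrable_const_bound)
    show "AE z in M \<Otimes>\<^sub>M M. norm (case z of (x, y) \<Rightarrow> (u y)\<^sup>2 * k x y) \<le> B\<^sup>2 * C"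
      using u2 k(1,2) B C
      by (intro AE_I2) (auto intro!: mult_mono mult_nonneg_nonneg simp: abs_mult)
  qed measurable
  have intu: "integrable M (\<lambda>x. (u x)\<^sup>2)"
    using u2 by (intro integrable_const_bound[where B = "B\<^sup>2"]) auto
  \<comment> \<open>One of the two equal integrals: the variable under the square is kept, and the kernel is integrated in the other.\<close>
  have row: "(LINT x|M. (LINT y|M. (u x)\<^sup>2 * k x y)) \<le> S * (LINT x|M. (u x)\<^sup>2)"
  proof -
    have "(LINT x|M. (LINT y|M. (u x)\<^sup>2 * k x y)) \<le> (LINT x|M. S * (u x)\<^sup>2)"
      using P.integrable_fst[OF int2] intu S
      by (intro integral_mono) (auto simp: mult.commute[of S] intro!: mult_left_mono)
    then show ?thesis by simp
  qed
  have "(LINT x|M. u x * (LINT y|M. u y * k y x)) = (LINT x|M. u x * (LINT y|M. u y * k x y))"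
    by (intro Bochner_Integration.integral_cong refl arg_cong2[where f = "(*)"] k(3))
  also have "\<dots> = (LINT x|M. (LINT y|M. u x * (u y * k x y)))" by simp
  also have "\<dots> = (LINT z|(M \<Otimes>\<^sub>M M). (case z of (x, y) \<Rightarrow> u x * (u y * k x y)))"
    by (rule P.integral_fst[OF int1])
  also have "\<dots> \<le> (LINT z|(M \<Otimes>\<^sub>M M). ((case z of (x, y) \<Rightarrow> (u x)\<^sup>2 * k x y) + (case z of (x, y) \<Rightarrow> (u y)\<^sup>2 * k x y)) / 2)"
  proof (intro integral_mono int1)
    fix z :: "'a \<times> 'a"
    obtain x y where z: "z = (x, y)" by (cases z)
    have "0 \<le> (u x - u y)\<^sup>2 * k x y" using k by simp
    then show "(case z of (x, y) \<Rightarrow> u x * (u y * k x y)) \<le>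
        ((case z of (x, y) \<Rightarrow> (u x)\<^sup>2 * k x y) + (case z of (x, y) \<Rightarrow> (u y)\<^sup>2 * k x y)) / 2"
      by (simp add: z power2_eq_square algebra_simps)
  qed (use int2 int3 in auto)
  also have "\<dots> = ((LINT z|(M \<Otimes>\<^sub>M M). (case z of (x, y) \<Rightarrow> (u x)\<^sup>2 * k x y)) +
      (LINT z|(M \<Otimes>\<^sub>M M). (case z of (x, y) \<Rightarrow> (u y)\<^sup>2 * k x y))) / 2"
    using int2 int3 by simp
  also have "(LINT z|(M \<Otimes>\<^sub>M M). (case z of (x, y) \<Rightarrow> (u x)\<^sup>2 * k x y)) = (LINT x|M. (LINT y|M. (u x)\<^sup>2 * k x y))"
    by (rule P.integral_fst[OF int2, symmetric])
  also have "(LINT z|(M \<Otimes>\<^sub>M M). (case z of (x, y) \<Rightarrow> (u y)\<^sup>2 * k x y)) = (LINT y|M. (LINT x|M. (u y)\<^sup>2 * k x y))"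
    by (rule P.integral_snd[OF int3, symmetric])
  also have "\<dots> = (LINT x|M. (LINT y|M. (u x)\<^sup>2 * k x y))"
    by (intro Bochner_Integration.integral_cong refl arg_cong2[where f = "(*)"] k(3))
  also have "(\<dots> + \<dots>) / 2 \<le> S * (LINT x|M. (u x)\<^sup>2)" using row by simp
  finally show ?thesis .
qed

context spectral_correlation
begin

text \<open>With \<open>h = B\<^sub>T f\<close> and \<open>H\<close> its Fourier integral,
  \<open>\<parallel>h\<parallel>\<^sup>2 = \<langle>B\<^sub>T f, h\<rangle> = \<integral> F H\<^sup>* d\<mu>\<close>,
  and \<open>H\<close> is the Dirichlet kernel applied to \<open>F\<close>; so the Schur test
  applies to \<open>\<bar>F\<bar>\<close>.\<close>

lemma L2_norm_corr_operator_sq_le: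
  assumes f: "f \<in> L2_space T"
    and S: "\<And>l. (LINT k|M. cmod (dirichlet_window T (k - l))) \<le> S" and T: "T > 0"
  shows "(L2_norm T (corr_operator b T f))\<^sup>2 \<le> S * (LINT l|M. (cmod (fourier_window T f l))\<^sup>2)"
proof -
  let ?h = "corr_operator b T f" and ?F = "fourier_window T f" and ?D = "dirichlet_window T"
  let ?H = "fourier_window T ?h"
  note fi = integrable_L2_space[OF f]
  note hi = integrable_L2_space[OF corr_operator_L2_space[OF f]]
  note [measurable] = borel_measurable_integrable[OF integrable_fourier_window[OF fi]]
    borel_measurable_integrable[OF integrable_fourier_window[OF hi]]
  have id[measurable]: "(\<lambda>l. l) \<in> borel_measurable M"
    by (subst measurable_cong_sets[OF M_is_borel refl]) simp
  have D: "integrable M (\<lambda>k. ?D (k - l))" for l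
    using cmod_dirichlet_window_le[OF T] by (intro integrable_const_bound[where B = T]) auto
  have "complex_of_real ((L2_norm T ?h)\<^sup>2) = (CLINT t|window T. ?h t * cnj (?h t))"
    by (simp add: L2_norm_def flip: integral_complex_of_real) (simp only: complex_norm_square[symmetric] of_real_power)
  also have "\<dots> = (CLINT l|M. ?F l * cnj (?H l))" by (rule corr_operator_inner[OF fi hi])
  finally have "(L2_norm T ?h)\<^sup>2 = cmod (CLINT l|M. ?F l * cnj (?H l))"
    by (metis norm_of_real abs_power2)
  also have "\<dots> \<le> (LINT l|M. cmod (?F l * cnj (?H l)))" by (rule integral_norm_bound)
  also have "\<dots> = (LINT l|M. cmod (?F l) * cmod (?H l))" by (simp add: norm_mult)
  also have "\<dots> \<le> (LINT l|M. cmod (?F l) * (LINT k|M. cmod (?F k) * cmod (?D (k - l))))"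
  proof (intro integral_mono mult_left_mono)
    have HF: "cmod (?H l) \<le> (LINT k|M. cmod (?F k) * cmod (?D (k - l)))" for l
      using integral_norm_bound[of M "\<lambda>k. ?F k * ?D (k - l)"]
      by (simp add: fourier_window_corr_operator[OF fi] norm_mult)
    then show "cmod (?H l) \<le> (LINT k|M. cmod (?F k) * cmod (?D (k - l)))" for l .
    have bd: "cmod (?F k) * cmod (?D (k - l)) \<le> (LINT s|window T. cmod (f s)) * T" for k l
      by (intro mult_mono cmod_fourier_window_le cmod_dirichlet_window_le T) auto
    have FDint: "integrable M (\<lambda>k. cmod (?F k) * cmod (?D (k - l)))" for l
      using bd by (intro integrable_const_bound[where B = "(LINT s|window T. cmod (f s)) * T"]) auto
    have in_le: "(LINT k|M. cmod (?F k) * cmod (?D (k - l))) \<le>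
        (LINT s|window T. cmod (f s)) * T * measure M UNIV" for l
      using integral_mono[OF FDint integrable_const bd] by (simp add: borel_UNIV mult_ac)
    show RHS: "integrable M (\<lambda>l. cmod (?F l) * (LINT k|M. cmod (?F k) * cmod (?D (k - l))))"
    proof (rule integrable_const_bound[where
          B = "(LINT s|window T. cmod (f s)) * ((LINT s|window T. cmod (f s)) * T * measure M UNIV)"])
      show "AE l in M. norm (cmod (?F l) * (LINT k|M. cmod (?F k) * cmod (?D (k - l)))) \<le>
        (LINT s|window T. cmod (f s)) * ((LINT s|window T. cmod (f s)) * T * measure M UNIV)"
        using in_le by (auto intro!: AE_I2 mult_mono cmod_fourier_window_le simp: abs_mult)
    qed measurable
    show "integrable M (\<lambda>l. cmod (?F l) * cmod (?H l))"
      by (rule Bochner_Integration.integrable_bound[OF RHS])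
         (auto intro!: AE_I2 mult_left_mono simp: abs_mult HF order_trans[OF HF abs_ge_self])
  qed simp
  also have "\<dots> \<le> S * (LINT l|M. (cmod (?F l))\<^sup>2)"
  proof (rule schur_test[OF finite_measure_axioms, where B = "LINT s|window T. cmod (f s)" and C = T])
    show "(LINT k|M. cmod (?D (l - k))) \<le> S" for l
      using S[of l] cmod_dirichlet_window_uminus[of T "l - _"] by simp
    show "cmod (?D (x - y)) = cmod (?D (y - x))" for x y
      using cmod_dirichlet_window_uminus[of T "x - y"] by simp
  qed (use cmod_fourier_window_le cmod_dirichlet_window_le[OF T] in auto)
  finally show ?thesis .
qed

end

section \<open>Bounds for the operator norm\<close>

lemma L2_norm_nonneg: "0 \<le> L2_norm T f"
  by (simp add: L2_norm_def)

lemma L2_norm_sq: "(L2_norm T f)\<^sup>2 = (LINT t|window T. (cmod (f t))\<^sup>2)"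
  by (simp add: L2_norm_def)

text \<open>The Cauchy--Schwarz inequality with a free weight \<open>a\<close>, which is chosen
  later as the expected operator norm, so that both terms on the right balance.\<close>

lemma cmod_L2_inner_le:
  assumes f: "f \<in> L2_space T" and g: "g \<in> L2_space T" and a: "a > 0"
  shows "cmod (CLINT t|window T. f t * cnj (g t)) \<le> ((L2_norm T f)\<^sup>2 / a + a * (L2_norm T g)\<^sup>2) / 2"
proof -
  have [measurable]: "f \<in> borel_measurable (window T)" "g \<in> borel_measurable (window T)"
    and sq: "integrable (window T) (\<lambda>t. (cmod (f t))\<^sup>2)" "integrable (window T) (\<lambda>t. (cmod (g t))\<^sup>2)"
    using f g by (simp_all add: L2_space_def)
  have amgm: "cmod (f t) * cmod (g t) \<le> ((cmod (f t))\<^sup>2 / a + a * (cmod (g t))\<^sup>2) / 2" for t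
  proof -
    have "0 \<le> (cmod (f t) - a * cmod (g t))\<^sup>2 / a" using a by simp
    also have "\<dots> = (cmod (f t))\<^sup>2 / a + a * (cmod (g t))\<^sup>2 - 2 * (cmod (f t) * cmod (g t))"
      using a by (simp add: power2_eq_square field_simps)
    finally show ?thesis by simp
  qed
  have rhs: "integrable (window T) (\<lambda>t. ((cmod (f t))\<^sup>2 / a + a * (cmod (g t))\<^sup>2) / 2)"
    using sq by simp
  have lhs: "integrable (window T) (\<lambda>t. cmod (f t) * cmod (g t))"
    by (rule Bochner_Integration.integrable_bound[OF rhs])
       (use amgm in \<open>auto intro!: AE_I2 intro: order_trans[OF _ abs_ge_self]\<close>)
  have "cmod (CLINT t|window T. f t * cnj (g t)) \<le> (LINT t|window T. cmod (f t * cnj (g t)))"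
    by (rule integral_norm_bound)
  also have "\<dots> = (LINT t|window T. cmod (f t) * cmod (g t))" by (simp add: norm_mult)
  also have "\<dots> \<le> (LINT t|window T. ((cmod (f t))\<^sup>2 / a + a * (cmod (g t))\<^sup>2) / 2)"
    by (rule integral_mono[OF lhs rhs amgm])
  also have "\<dots> = ((L2_norm T f)\<^sup>2 / a + a * (L2_norm T g)\<^sup>2) / 2"
    using sq by (simp add: L2_norm_sq)
  finally show ?thesis .
qed

lemma iexp_L2_space: "(\<lambda>t. iexp (l * t)) \<in> L2_space T"
proof -
  interpret N: finite_measure "window T" by (rule finite_measure_window)
  show ?thesis by (simp add: L2_space_def)
qed

lemma L2_norm_iexp_sq: "T > 0 \<Longrightarrow> (L2_norm T (\<lambda>t. iexp (l * t)))\<^sup>2 = T"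
  using integral_window_const[of T 1] by (simp add: L2_norm_sq)

context spectral_correlation
begin

text \<open>The left-hand side is \<open>\<langle>B\<^sub>T f, f\<rangle>\<close>.\<close>

lemma spectral_energy_le:
  assumes f: "f \<in> L2_space T" and a: "a > 0"
  shows "(LINT l|M. (cmod (fourier_window T f l))\<^sup>2)
         \<le> ((L2_norm T (corr_operator b T f))\<^sup>2 / a + a * (L2_norm T f)\<^sup>2) / 2"
proof -
  let ?E = "LINT l|M. (cmod (fourier_window T f l))\<^sup>2"
  have "complex_of_real ?E = (CLINT l|M. fourier_window T f l * cnj (fourier_window T f l))"
    by (simp add: flip: integral_complex_of_real)
       (simp only: complex_norm_square[symmetric] of_real_power)
  also have "\<dots> = (CLINT t|window T. corr_operator b T f t * cnj (f t))"
    by (rule corr_operator_inner[symmetric]) (rule integrable_L2_space[OF f])+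
  finally have E: "complex_of_real ?E = (CLINT t|window T. corr_operator b T f t * cnj (f t))" .
  have "?E \<le> cmod (complex_of_real ?E)" by simp
  also have "\<dots> \<le> ((L2_norm T (corr_operator b T f))\<^sup>2 / a + a * (L2_norm T f)\<^sup>2) / 2"
    unfolding E by (rule cmod_L2_inner_le[OF corr_operator_L2_space[OF f] f a])
  finally show ?thesis .
qed

text \<open>The Schur bound and the energy bound combine to
  \<open>\<parallel>B\<^sub>T f\<parallel>\<^sup>2 \<le> S \<langle>B\<^sub>T f, f\<rangle> \<le> (\<parallel>B\<^sub>T f\<parallel>\<^sup>2 + S\<^sup>2 \<parallel>f\<parallel>\<^sup>2)/2\<close>
  by taking the weight \<open>a = S\<close>.\<close>

lemma L2_norm_corr_operator_le:
  assumes f: "f \<in> L2_space T" and T: "T > 0" and "S > 0"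
    and S: "\<And>l. (LINT k|M. cmod (dirichlet_window T (k - l))) \<le> S"
  shows "L2_norm T (corr_operator b T f) \<le> S * L2_norm T f"
proof (rule power2_le_imp_le)
  let ?h = "L2_norm T (corr_operator b T f)" and ?E = "LINT l|M. (cmod (fourier_window T f l))\<^sup>2"
  have "?h\<^sup>2 \<le> S * ?E" by (rule L2_norm_corr_operator_sq_le[OF f S T])
  also have "\<dots> \<le> S * ((?h\<^sup>2 / S + S * (L2_norm T f)\<^sup>2) / 2)"
    using \<open>S > 0\<close> by (intro mult_left_mono spectral_energy_le f) auto
  also have "\<dots> = ?h\<^sup>2 / 2 + (S * L2_norm T f)\<^sup>2 / 2"
    using \<open>S > 0\<close> by (simp add: field_simps power2_eq_square)
  finally show "?h\<^sup>2 \<le> (S * L2_norm T f)\<^sup>2" by simp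
qed (use \<open>S > 0\<close> L2_norm_nonneg in simp)

lemma corr_quotient_le:
  assumes "f \<in> L2_space T" "T > 0" "S > 0"
    and "\<And>l. (LINT k|M. cmod (dirichlet_window T (k - l))) \<le> S"
  shows "L2_norm T (corr_operator b T f) / L2_norm T f \<le> S"
proof (cases "L2_norm T f = 0")
  case False
  then have "L2_norm T f > 0" using L2_norm_nonneg[of T f] by simp
  then show ?thesis using L2_norm_corr_operator_le[OF assms] by (simp add: divide_le_eq)
qed (use \<open>S > 0\<close> in simp)

lemma L2_onorm_corr_operator_le:
  assumes "T > 0" "S > 0"
    and "\<And>l. (LINT k|M. cmod (dirichlet_window T (k - l))) \<le> S"
  shows "L2_onorm T (corr_operator b T) \<le> S"
  unfolding L2_onorm_def
  using iexp_L2_space corr_quotient_le[OF _ assms] by (intro cSUP_least) auto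

lemma integrable_dirichlet_window:
  assumes "T > 0"
  shows "integrable M (\<lambda>k. cmod (dirichlet_window T (k - l)))"
proof (rule integrable_const_bound)
  have [measurable]: "(\<lambda>l. l) \<in> borel_measurable M"
    by (subst measurable_cong_sets[OF M_is_borel refl]) simp
  show "(\<lambda>k. cmod (dirichlet_window T (k - l))) \<in> borel_measurable M" by measurable
qed (use cmod_dirichlet_window_le[OF assms] in auto)

text \<open>Boundedness is what makes the supremum of real numbers in
  \<^const>\<open>L2_onorm\<close> an upper bound; the crude estimate of the kernel by
  \<open>T\<close> suffices, and the summand \<open>1\<close> keeps the constant positive when
  \<open>\<mu>\<close> vanishes.\<close>

lemma bdd_above_corr_quotients:
  assumes T: "T > 0"
  shows "bdd_above ((\<lambda>f. L2_norm T (corr_operator b T f) / L2_norm T f) ` L2_space T)"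
proof (rule bdd_aboveI2, rule corr_quotient_le)
  show "T * measure M UNIV + 1 > 0" using T by (simp add: add_nonneg_pos)
  fix l
  have "(LINT k|M. cmod (dirichlet_window T (k - l))) \<le> (LINT k|M. T)"
    by (intro integral_mono integrable_dirichlet_window integrable_const cmod_dirichlet_window_le T)
  then show "(LINT k|M. cmod (dirichlet_window T (k - l))) \<le> T * measure M UNIV + 1"
    by (simp add: borel_UNIV mult.commute)
qed (use T in auto)

text \<open>The exponential of frequency \<open>x\<close> has Fourier integral \<open>T\<close> at
  \<open>x\<close>, so the atom alone contributes \<open>T\<^sup>2 \<mu>{x}\<close> to
  \<open>\<langle>B\<^sub>T f, f\<rangle>\<close>, whereas
  \<open>\<parallel>f\<parallel>\<^sup>2 = T\<close>.\<close>

lemma L2_onorm_corr_operator_ge_atom: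
  assumes T: "T > 0"
  shows "T * measure M {x} \<le> L2_onorm T (corr_operator b T)"
proof -
  let ?f = "\<lambda>t. iexp (x * t)" and ?m = "measure M {x}"
  let ?h = "L2_norm T (corr_operator b T ?f)"
  have nf: "(L2_norm T ?f)\<^sup>2 = T" by (rule L2_norm_iexp_sq[OF T])
  have pos: "L2_norm T ?f > 0" using nf T L2_norm_nonneg[of T ?f] by (auto simp: less_le)
  have "T * ?m * L2_norm T ?f \<le> ?h"
  proof (cases "?m = 0")
    case True
    then show ?thesis by (simp add: L2_norm_nonneg)
  next
    case False
    then have m: "?m > 0" using measure_nonneg[of M "{x}"] by linarith
    have Fx: "fourier_window T ?f x = T"
      using integral_window_const[OF T, of 1]
      by (simp add: fourier_window_def measure_restrict_space exp_add[symmetric] T scaleR_conv_of_real)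
    have "T\<^sup>2 * ?m = (LINT l|M. T\<^sup>2 * indicator {x} l)" by (simp add: borel_UNIV)
    also have "\<dots> \<le> (LINT l|M. (cmod (fourier_window T ?f l))\<^sup>2)"
    proof (rule integral_mono)
      show "integrable M (\<lambda>l. (cmod (fourier_window T ?f l))\<^sup>2)"
        by (rule integrable_fourier_window_sq[OF integrable_L2_space[OF iexp_L2_space]])
      show "integrable M (\<lambda>l. T\<^sup>2 * indicator {x} l)"
        by (intro integrable_mult_right integrable_real_indicator)
           (simp_all add: less_top[symmetric] M_is_borel)
      fix l
      have "cmod (fourier_window T ?f x) = T" unfolding Fx using T by simp
      then show "T\<^sup>2 * indicator {x} l \<le> (cmod (fourier_window T ?f l))\<^sup>2"
        by (cases "l = x") (simp_all only: indicator_simps singleton_iff mult_1_right mult_zero_right order_refl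
            zero_le_power2 simp_thms)
    qed
    \<comment> \<open>The weight is the norm to be proved, for which the two summands are equal when the bound is sharp.\<close>
    also have "\<dots> \<le> (?h\<^sup>2 / (T * ?m) + (T * ?m) * (L2_norm T ?f)\<^sup>2) / 2"
      using T m by (intro spectral_energy_le iexp_L2_space) simp
    finally have "T\<^sup>2 * ?m \<le> (?h\<^sup>2 / (T * ?m) + (T * ?m) * T) / 2" unfolding nf .
    then have "T\<^sup>2 * ?m \<le> ?h\<^sup>2 / (T * ?m)" by (simp add: power2_eq_square)
    then have "T\<^sup>2 * ?m * (T * ?m) \<le> ?h\<^sup>2" using T m by (simp add: pos_le_divide_eq)
    then have "(T * ?m * L2_norm T ?f)\<^sup>2 \<le> ?h\<^sup>2"
      by (simp only: power_mult_distrib nf) (simp add: power2_eq_square mult_ac)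
    then show ?thesis by (rule power2_le_imp_le) (rule L2_norm_nonneg)
  qed
  then have "T * ?m \<le> ?h / L2_norm T ?f" using pos by (simp add: pos_le_divide_eq)
  also have "\<dots> \<le> L2_onorm T (corr_operator b T)"
    unfolding L2_onorm_def
    by (rule cSUP_upper[OF iexp_L2_space bdd_above_corr_quotients[OF T]])
  finally show ?thesis .
qed

text \<open>Within distance \<open>d\<close> of \<open>l\<close> the kernel is at most
  \<open>T\<close>, farther away at most \<open>2/d\<close>.\<close>

lemma dirichlet_window_integral_le:
  assumes T: "T > 0" and d: "d > 0" and c: "\<And>x. measure M {x - d..x + d} \<le> c"
  shows "(LINT k|M. cmod (dirichlet_window T (k - l))) \<le> T * c + 2 / d * measure M UNIV"
proof -
  have "(LINT k|M. cmod (dirichlet_window T (k - l))) \<le> (LINT k|M. T * indicator {l - d..l + d} k + 2 / d)"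
  proof (intro integral_mono integrable_dirichlet_window T)
    fix k
    show "cmod (dirichlet_window T (k - l)) \<le> T * indicator {l - d..l + d} k + 2 / d"
    proof (cases "k \<in> {l - d..l + d}")
      case True
      then show ?thesis using cmod_dirichlet_window_le[OF T, of "k - l"] d
        by (simp add: add_increasing2)
    next
      case False
      then have far: "d \<le> \<bar>k - l\<bar>" "k - l \<noteq> 0" using d by auto
      have "cmod (dirichlet_window T (k - l)) \<le> 2 / \<bar>k - l\<bar>"
        by (rule cmod_dirichlet_window_decay[OF T far(2)])
      also have "\<dots> \<le> 2 / d" using far d by (intro divide_left_mono) auto
      finally show ?thesis using False by simp
    qed
    show "integrable M (\<lambda>k. T * indicator {l - d..l + d} k + 2 / d)"
      by (intro Bochner_Integration.integrable_add integrable_const integrable_mult_right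
          integrable_real_indicator) (simp_all add: less_top[symmetric] M_is_borel)
  qed
  also have "\<dots> = T * measure M {l - d..l + d} + 2 / d * measure M UNIV"
    by (subst Bochner_Integration.integral_add) (auto simp: less_top[symmetric] borel_UNIV M_is_borel)
  also have "\<dots> \<le> T * c + 2 / d * measure M UNIV" using c[of l] T by simp
  finally show ?thesis .
qed

text \<open>Dividing the bounds by \<open>T\<close> leaves the heaviest atom below, and above a
  bound \<open>c\<close> for short intervals plus a term \<open>O(1/T)\<close>; here
  \<open>c\<close> may be any number exceeding the heaviest atom.\<close>

theorem L2_onorm_corr_operator_tendsto:
  assumes max: "\<And>y. measure M {y} \<le> measure M {x}"
  shows "((\<lambda>T. 1 / T * L2_onorm T (corr_operator b T)) \<longlongrightarrow> measure M {x}) at_top"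
proof (rule order_tendstoI)
  fix a assume a: "a < measure M {x}"
  show "\<forall>\<^sub>F T in at_top. a < 1 / T * L2_onorm T (corr_operator b T)"
    using eventually_gt_at_top[of 0]
  proof eventually_elim
    case (elim T)
    then have "measure M {x} \<le> 1 / T * L2_onorm T (corr_operator b T)"
      using L2_onorm_corr_operator_ge_atom[of T x] by (simp add: field_simps)
    with a show ?case by linarith
  qed
next
  fix a assume a: "measure M {x} < a"
  define c where "c = (measure M {x} + a) / 2"
  have c: "measure M {x} < c" "c < a" using a by (auto simp: c_def)
  have "c > 0" using c(1) measure_nonneg[of M "{x}"] by linarith
  obtain d where d: "d > 0" "\<And>y. measure M {y - d..y + d} \<le> c"
    using uniformly_small_intervals[of c] max c(1) by (meson le_less_trans)
  have "((\<lambda>T. c + 2 / d * measure M UNIV * inverse T) \<longlongrightarrow> c + 2 / d * measure M UNIV * 0) at_top"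
    by (intro tendsto_intros tendsto_inverse_0_at_top filterlim_ident)
  then have "\<forall>\<^sub>F T in at_top. c + 2 / d * measure M UNIV * inverse T < a"
    using c(2) by (intro order_tendstoD(2)) auto
  then show "\<forall>\<^sub>F T in at_top. 1 / T * L2_onorm T (corr_operator b T) < a"
    using eventually_gt_at_top[of 0]
  proof eventually_elim
    case (elim T)
    have "T * c + 2 / d * measure M UNIV > 0"
      using elim d(1) \<open>c > 0\<close> by (intro add_pos_nonneg) auto
    from L2_onorm_corr_operator_le[OF elim(2) this dirichlet_window_integral_le[OF elim(2) d]]
    have "1 / T * L2_onorm T (corr_operator b T) \<le> 1 / T * (T * c + 2 / d * measure M UNIV)"
      using elim by (intro mult_left_mono) auto
    also have "\<dots> = c + 2 / d * measure M UNIV * inverse T" using elim by (simp add: field_simps)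
    finally show ?case using elim(1) by linarith
  qed
qed

end

section \<open>Stability and the jumps of the spectral function\<close>

lemma spectral_correlation_stieltjes:
  assumes "spectral_distribution b \<theta>"
  shows "spectral_correlation (stieltjes_measure \<theta>) b"
  using assms unfolding spectral_distribution_def
  by (intro spectral_correlation.intro spectral_correlation_axioms.intro finite_borel_measure_stieltjes) auto

lemma isCont_iff_atom_null:
  assumes "spectral_distribution b \<theta>"
  shows "isCont \<theta> x \<longleftrightarrow> measure (stieltjes_measure \<theta>) {x} = 0"
  using assms by (simp add: spectral_distribution_def isCont_iff_no_jump measure_stieltjes_singleton)

lemma jumps_eq_atom_masses:
  assumes "spectral_distribution b \<theta>"
  shows "jumps \<theta> = {measure (stieltjes_measure \<theta>) {x} | x. measure (stieltjes_measure \<theta>) {x} \<noteq> 0}"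
  using assms isCont_iff_atom_null[OF assms]
  by (simp add: jumps_def spectral_distribution_def measure_stieltjes_singleton)

theorem theorem4p2:
  fixes M :: "'a measure" and \<xi> :: "real \<Rightarrow> 'a \<Rightarrow> complex"
    and b :: "real \<Rightarrow> complex" and \<theta> :: "real \<Rightarrow> real"
  assumes "stationary_process M \<xi>"
    and "b = correlation_function M \<xi>"
    and "continuous_on UNIV b"
    and "spectral_distribution b \<theta>"
  shows "(stable_process M \<xi> \<longleftrightarrow>
            ((\<lambda>T. 1 / T * L2_onorm T (corr_operator b T)) \<longlongrightarrow> 0) at_top) \<and>
         (\<not> stable_process M \<xi> \<longrightarrow>
            (\<exists>m\<in>jumps \<theta>. (\<forall>m'\<in>jumps \<theta>. m' \<le> m) \<and>
               ((\<lambda>T. 1 / T * L2_onorm T (corr_operator b T)) \<longlongrightarrow> m) at_top))"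
proof -
  let ?norm = "\<lambda>T. 1 / T * L2_onorm T (corr_operator b T)"
  let ?\<mu> = "stieltjes_measure \<theta>"
  interpret spectral_correlation ?\<mu> b by (rule spectral_correlation_stieltjes[OF assms(4)])
  obtain x where max: "\<And>y. measure ?\<mu> {y} \<le> measure ?\<mu> {x}" using heaviest_atom by blast
  have lim: "(?norm \<longlongrightarrow> measure ?\<mu> {x}) at_top" by (rule L2_onorm_corr_operator_tendsto[OF max])
  have cont_iff: "continuous_on UNIV \<theta> \<longleftrightarrow> measure ?\<mu> {x} = 0"
  proof -
    have "continuous_on UNIV \<theta> \<longleftrightarrow> (\<forall>y. measure ?\<mu> {y} = 0)"
      by (simp add: continuous_on_eq_continuous_at isCont_iff_atom_null[OF assms(4)])
    also have "\<dots> \<longleftrightarrow> measure ?\<mu> {x} = 0"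
      using max by (metis antisym measure_nonneg)
    finally show ?thesis .
  qed
  have stable_lim: "(?norm \<longlongrightarrow> 0) at_top" if stable: "stable_process M \<xi>"
  proof -
    obtain \<theta>' where \<theta>': "spectral_distribution b \<theta>'" "continuous_on UNIV \<theta>'"
      using stable assms(2) by (auto simp: stable_process_def)
    interpret \<theta>': spectral_correlation "stieltjes_measure \<theta>'" b
      by (rule spectral_correlation_stieltjes[OF \<theta>'(1)])
    have "measure (stieltjes_measure \<theta>') {y} = 0" for y
      using \<theta>'(2) isCont_iff_atom_null[OF \<theta>'(1)] by (simp add: continuous_on_eq_continuous_at)
    with \<theta>'.L2_onorm_corr_operator_tendsto[of 0] show ?thesis by simp
  qed
  have lim_stable: "stable_process M \<xi>" if "measure ?\<mu> {x} = 0"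
    using that cont_iff assms(2,4) by (auto simp: stable_process_def)
  have "stable_process M \<xi> \<longleftrightarrow> (?norm \<longlongrightarrow> 0) at_top"
  proof
    assume "(?norm \<longlongrightarrow> 0) at_top"
    then have "measure ?\<mu> {x} = 0" using lim by (intro tendsto_unique[OF trivial_limit_at_top_linorder])
    then show "stable_process M \<xi>" by (rule lim_stable)
  qed (rule stable_lim)
  moreover have "measure ?\<mu> {x} \<in> jumps \<theta> \<and> (\<forall>m'\<in>jumps \<theta>. m' \<le> measure ?\<mu> {x})"
    if "\<not> stable_process M \<xi>"
    using that lim_stable max by (auto simp: jumps_eq_atom_masses[OF assms(4)])
  ultimately show ?thesis using lim by blast
qed

end
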